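(* For every $k\ge1$ and every $r\in\{0,1,\dots,2k\}$, $$r>0\ \Longrightarrow\ \mathcal A_k(r)\equiv r+1\pmod 2,$$ and $$\mathcal A_k(0)\equiv0\pmod2.$$
   Context: $\tau(n)$ is the number of positive divisors of $n$; $T(n)=n+\tau(n)$ on the positive integers, with iterates $T^s$. For $k\ge1$ the annular transfer map $\mathcal A_k:\{0,1,\dots,2k\}\to\{0,1,\dots,2k+2\}$ is defined as follows: for $0\le r\le 2k$, let $s\ge1$ be minimal with $T^s(k^2+r)\ge (k+1)^2$; then $\mathcal A_k(r)=T^s(k^2+r)-(k+1)^2$. *)

theory Defs
  imports "HOL-Number_Theory.Cong"
begin

definition tau :: "nat \<Rightarrow> nat" where
  "tau n = card {d. d dvd n}"

definition T :: "nat \<Rightarrow> nat" where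
  "T n = n + tau n"

definition exit_time :: "nat \<Rightarrow> nat \<Rightarrow> nat" where
  "exit_time k r = (LEAST s. s \<ge> 1 \<and> (T ^^ s) (k\<^sup>2 + r) \<ge> (k + 1)\<^sup>2)"

text \<open>The annular transfer map, meaningful for \<open>k \<ge> 1\<close> and \<open>r \<le> 2 * k\<close>. By \<open>exit_time_reached\<close> below,
  the minimum defining the exit time exists and the subtraction is not truncated.\<close>

definition annular_transfer :: "nat \<Rightarrow> nat \<Rightarrow> nat" where
  "annular_transfer k r = (T ^^ exit_time k r) (k\<^sup>2 + r) - (k + 1)\<^sup>2"

lemma tau_pos:
  assumes "n > 0"
  shows "tau n > 0"
proof -
  have "finite {d. d dvd n}" using assms by simp
  moreover have "1 \<in> {d. d dvd n}" by simp
  ultimately show ?thesis unfolding tau_def by (metis card_gt_0_iff empty_iff)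
qed

lemma T_iterate_ge:
  assumes "n > 0"
  shows "(T ^^ s) n \<ge> n + s"
proof (induction s)
  case (Suc s)
  have "tau ((T ^^ s) n) > 0" using Suc assms by (intro tau_pos) linarith
  then show ?case using Suc by (simp add: T_def[of "(T ^^ s) n"])
qed simp

lemma exit_time_reached:
  assumes "k \<ge> 1"
  shows "exit_time k r \<ge> 1" "(T ^^ exit_time k r) (k\<^sup>2 + r) \<ge> (k + 1)\<^sup>2"
proof -
  have "(k + 1)\<^sup>2 \<ge> 1 \<and> (T ^^ ((k + 1)\<^sup>2)) (k\<^sup>2 + r) \<ge> (k + 1)\<^sup>2"
    using T_iterate_ge[of "k\<^sup>2 + r" "(k + 1)\<^sup>2"] assms by simp
  then have "exit_time k r \<ge> 1 \<and> (T ^^ exit_time k r) (k\<^sup>2 + r) \<ge> (k + 1)\<^sup>2"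
    unfolding exit_time_def by (rule LeastI)
  then show "exit_time k r \<ge> 1" "(T ^^ exit_time k r) (k\<^sup>2 + r) \<ge> (k + 1)\<^sup>2" by auto
qed

end

theory Submission
  imports Defs
begin

text \<open>Pairing each divisor \<open>d\<close> of \<open>n\<close> with \<open>n div d\<close> leaves only a square root of \<open>n\<close> unpaired, so
  \<open>tau n\<close> is odd exactly when \<open>n\<close> is a square (\<open>odd_tau_iff_square\<close>). Hence a step of \<open>T\<close> changes the
  parity exactly when it starts at a square.

  Strictly between \<open>k\<^sup>2\<close> and \<open>(k + 1)\<^sup>2\<close> there are no squares. An orbit starting at \<open>k\<^sup>2 + r\<close> with
  \<open>r > 0\<close> therefore keeps its parity until it leaves the annulus, while one starting at \<open>k\<^sup>2\<close> changes
  it exactly once, at the first step (\<open>orbit_parity\<close>). Since \<open>k\<^sup>2 - (k + 1)\<^sup>2\<close> is odd, subtracting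
  \<open>(k + 1)\<^sup>2\<close> at the exit gives the parity of \<open>r + 1\<close> in the first case and \<open>0\<close> in the second.\<close>

lemma odd_tau_iff_square:
  assumes "n > 0"
  shows "odd (tau n) \<longleftrightarrow> (\<exists>m. n = m\<^sup>2)"
proof -
  define S L M where "S = {d. d dvd n \<and> d\<^sup>2 < n}" and "L = {d. d dvd n \<and> d\<^sup>2 > n}"
    and "M = {d. d dvd n \<and> d\<^sup>2 = n}"
  have fin: "finite {d. d dvd n}"
    using assms by simp
  have finS: "finite S" and finL: "finite L" and finM: "finite M"
    unfolding S_def L_def M_def by (auto intro: finite_subset[OF _ fin])
  have swap: "n div d dvd n \<and> n div (n div d) = d \<and> (d\<^sup>2 < n \<longleftrightarrow> (n div d)\<^sup>2 > n)
      \<and> (d\<^sup>2 > n \<longleftrightarrow> (n div d)\<^sup>2 < n)" if d: "d dvd n" for d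
  proof -
    obtain e where e: "n = d * e" using d by blast
    with assms show ?thesis by (auto simp: power2_eq_square)
  qed
  have "bij_betw (\<lambda>d. n div d) S L"
    by (rule bij_betw_byWitness[where f' = "\<lambda>d. n div d"]) (use swap in \<open>auto simp: S_def L_def\<close>)
  then have "card S = card L"
    by (rule bij_betw_same_card)
  moreover have "{d. d dvd n} = (S \<union> L) \<union> M"
    unfolding S_def L_def M_def by auto
  moreover have "card ((S \<union> L) \<union> M) = card S + card L + card M"
  proof -
    have "S \<inter> L = {}" "(S \<union> L) \<inter> M = {}"
      by (auto simp: S_def L_def M_def)
    with finS finL finM show ?thesis by (simp add: card_Un_disjoint)
  qed
  ultimately have tau: "tau n = 2 * card S + card M"
    by (simp add: tau_def)
  show ?thesis
  proof (cases "\<exists>m. n = m\<^sup>2")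
    case True
    then obtain m where "n = m\<^sup>2" by blast
    then have "M = {m}"
      by (auto simp: M_def)
    with True tau show ?thesis by simp
  next
    case False
    then have "M = {}"
      by (auto simp: M_def)
    with False tau show ?thesis by simp
  qed
qed

lemma not_square_between_consecutive_squares:
  fixes k n :: nat
  assumes "k\<^sup>2 < n" and "n < (k + 1)\<^sup>2"
  shows "\<not> (\<exists>m. n = m\<^sup>2)"
proof
  assume "\<exists>m. n = m\<^sup>2"
  then obtain m where "n = m\<^sup>2" ..
  with assms have "k < m" "m < k + 1"
    by (auto intro: power_less_imp_less_base[where n = 2])
  then show False by simp
qed

lemma before_exit:
  assumes "s \<ge> 1" and "s < exit_time k r"
  shows "(T ^^ s) (k\<^sup>2 + r) < (k + 1)\<^sup>2"
  using not_less_Least[OF assms(2)[unfolded exit_time_def]] assms(1) by simp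

text \<open>The parity is followed only from the first iterate on: from there until the exit the orbit lies
  strictly above \<open>k\<^sup>2\<close>, so only the first step can start at a square, and it does so just for
  \<open>r = 0\<close>.\<close>

lemma orbit_parity:
  assumes k: "k \<ge> 1" and r: "r \<le> 2 * k" and "s \<ge> 1" and "s \<le> exit_time k r"
  shows "even ((T ^^ s) (k\<^sup>2 + r)) \<longleftrightarrow> even (k + r + (if r = 0 then 1 else 0))"
  using assms(3,4)
proof (induction s rule: dec_induct)
  case base
  have "odd (tau (k\<^sup>2 + r)) \<longleftrightarrow> r = 0"
  proof (cases "r = 0")
    case True
    then show ?thesis
      using odd_tau_iff_square[of "k\<^sup>2"] k by auto
  next
    case False
    then have "\<not> (\<exists>m. k\<^sup>2 + r = m\<^sup>2)"
      using r by (intro not_square_between_consecutive_squares[of k]) (auto simp: power2_eq_square)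
    with False show ?thesis
      using odd_tau_iff_square[of "k\<^sup>2 + r"] by simp
  qed
  then show ?case
    by (auto simp: T_def)
next
  case (step s)
  let ?n = "(T ^^ s) (k\<^sup>2 + r)"
  have "k\<^sup>2 < ?n"
    using T_iterate_ge[of "k\<^sup>2 + r" s] k step.hyps by simp
  moreover have "?n < (k + 1)\<^sup>2"
    using step.hyps step.prems by (intro before_exit) auto
  ultimately have "even (tau ?n)"
    using odd_tau_iff_square[of ?n] not_square_between_consecutive_squares[of k ?n] by simp
  with step show ?case
    by (simp add: T_def[of ?n])
qed

lemma annular_transfer_parity:
  assumes "k \<ge> 1" and "r \<le> 2 * k"
  shows "even (annular_transfer k r) \<longleftrightarrow> r = 0 \<or> odd r"
proof -
  have "even ((T ^^ exit_time k r) (k\<^sup>2 + r)) \<longleftrightarrow> even (k + r + (if r = 0 then 1 else 0))"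
    using orbit_parity[OF assms] exit_time_reached(1)[OF assms(1)] by blast
  moreover have "(T ^^ exit_time k r) (k\<^sup>2 + r) = annular_transfer k r + (k + 1)\<^sup>2"
    using exit_time_reached(2)[OF assms(1)] by (simp add: annular_transfer_def)
  ultimately show ?thesis
    by (auto split: if_splits)
qed

theorem proposition6p1:
  fixes k r :: nat
  assumes "k \<ge> 1" and "r \<in> {0..2 * k}"
  shows "(r > 0 \<longrightarrow> [annular_transfer k r = r + 1] (mod 2)) \<and> [annular_transfer k 0 = 0] (mod 2)"
proof (intro conjI impI)
  assume "r > 0"
  then show "[annular_transfer k r = r + 1] (mod 2)"
    using annular_transfer_parity[of k r] assms by (auto simp: cong_def mod2_eq_if)
next
  show "[annular_transfer k 0 = 0] (mod 2)"
    using annular_transfer_parity[of k 0] assms(1) by (simp add: cong_def mod2_eq_if)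
qed

end
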